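(* Let $\epsilon>0$. Let $0<p_1<1<p_2$ be such that $\tilde\gamma(p_1)<\gamma^*$ and $\tilde\gamma(p_2)<\gamma^*$, and let $0<\delta<\min\left(\gamma^*-\tilde\gamma(p_1),\gamma^*-\tilde\gamma(p_2)\right)$. Fix the integer $k\ge1$ to be such that $(1+\ln k)/k\le\delta^2\epsilon^2/16$. Then $$\mathbb{P}\left(D^n_{\epsilon,p_1,p_2}\right)\ge 1-2\exp\left(-n\left(-\frac{1+\ln k}{k}+\frac{\delta^2\epsilon^2}{16}\right)\right)$$ for all $n=km$ ($m$ a positive integer) large enough, i.e. for all such $n\ge n_0(\epsilon,\delta)$ (the law of $X_1$ and $p_1,p_2$ being fixed).
   Context: Let $(X_i)_{i\ge1}$ and $(Y_i)_{i\ge1}$ be two independent iid sequences with the same non-degenerate law on a finite alphabet $\mathcal{A}$. For finite strings $x,y$, $|LCS(x;y)|$ denotes the length of a longest common subsequence (i.e. the maximal length of a string that is a, not necessarily contiguous, subsequence of both $x$ and $y$). Put $LC_n:=|LCS(X_1\cdots X_n;Y_1\cdots Y_n)|$ and $\gamma^*:=\lim_{n\to\infty}\mathbb{E}LC_n/n=\sup_{n\ge1}\mathbb{E}LC_n/n$. For $p>0$ let $$\tilde\gamma(p):=\lim_{n\to\infty}\frac{\mathbb{E}|LCS(X_1X_2\cdots X_n;Y_1Y_2\cdots Y_{np})|}{n(1+p)/2},$$ where a non-integer index $np$ is rounded up to the nearest positive integer (this limit exists, and $\tilde\gamma(1)=\gamma^*$). Throughout $n=km$ with $k,m$ positive integers.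 An alignment of $X_1\cdots X_n$ with $Y_1\cdots Y_n$ is represented by the set of points $(i,j)\in\{1,\dots,n\}^2$ such that the $i$-th letter of $X$ is aligned with the $j$-th letter of $Y$; that is, by a set $\{(i_1,j_1),\dots,(i_\ell,j_\ell)\}$ with $i_1<\cdots<i_\ell$, $j_1<\cdots<j_\ell$ and $X_{i_s}=Y_{j_s}$ for all $s$. The alignment is optimal if it corresponds to a longest common subsequence, i.e. if $\ell=LC_n$. For $\epsilon,p_1,p_2>0$, $D^n_{\epsilon,p_1,p_2}$ is the event that all the points $(x,y)$ representing any optimal alignment of $X_1\cdots X_n$ with $Y_1\cdots Y_n$ are above (or on) the line $y=p_1x-p_1n\epsilon-p_1k$ and below (or on) the line $y=p_2x+p_2n\epsilon+p_2k$. *)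

theory Defs
  imports "HOL-Probability.Probability" "HOL-Library.Sublist"
begin

definition lcs_length :: "'a list \<Rightarrow> 'a list \<Rightarrow> nat" where
  "lcs_length x y = Max {length z | z. subseq z x \<and> subseq z y}"

text \<open>Sequences are indexed from 1; their value at 0 is never used.\<close>

definition word :: "(nat \<Rightarrow> 'a) \<Rightarrow> nat \<Rightarrow> 'a list" where
  "word x n = map x [1..<Suc n]"

definition LCS_rv :: "(nat \<Rightarrow> 'w \<Rightarrow> 'a) \<Rightarrow> (nat \<Rightarrow> 'w \<Rightarrow> 'a) \<Rightarrow> nat \<Rightarrow> nat \<Rightarrow> 'w \<Rightarrow> nat" where
  "LCS_rv X Y m n \<omega> = lcs_length (word (\<lambda>i. X i \<omega>) m) (word (\<lambda>j. Y j \<omega>) n)"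

definition gamma_star :: "'w measure \<Rightarrow> (nat \<Rightarrow> 'w \<Rightarrow> 'a) \<Rightarrow> (nat \<Rightarrow> 'w \<Rightarrow> 'a) \<Rightarrow> real" where
  "gamma_star M X Y = lim (\<lambda>n. (LINT \<omega>|M. real (LCS_rv X Y n n \<omega>)) / real n)"

definition gamma_tilde :: "'w measure \<Rightarrow> (nat \<Rightarrow> 'w \<Rightarrow> 'a) \<Rightarrow> (nat \<Rightarrow> 'w \<Rightarrow> 'a) \<Rightarrow> real \<Rightarrow> real" where
  "gamma_tilde M X Y p =
     lim (\<lambda>n. (LINT \<omega>|M. real (LCS_rv X Y n (nat \<lceil>real n * p\<rceil>) \<omega>)) / (real n * (1 + p) / 2))"

definition alignment :: "(nat \<Rightarrow> 'a) \<Rightarrow> (nat \<Rightarrow> 'a) \<Rightarrow> nat \<Rightarrow> (nat \<times> nat) set \<Rightarrow> bool" where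
  "alignment x y n S \<longleftrightarrow>
     (\<exists>(l::nat) (i::nat \<Rightarrow> nat) (j::nat \<Rightarrow> nat). S = (\<lambda>s. (i s, j s)) ` {1..l} \<and>
        strict_mono_on {1..l} i \<and> strict_mono_on {1..l} j \<and>
        (\<forall>s\<in>{1..l}. i s \<in> {1..n} \<and> j s \<in> {1..n} \<and> x (i s) = y (j s)))"

text \<open>Strict monotonicity makes the number of aligned pairs equal to the cardinality of the set.\<close>

definition optimal_alignment :: "(nat \<Rightarrow> 'a) \<Rightarrow> (nat \<Rightarrow> 'a) \<Rightarrow> nat \<Rightarrow> (nat \<times> nat) set \<Rightarrow> bool" where
  "optimal_alignment x y n S \<longleftrightarrow>
     alignment x y n S \<and> card S = lcs_length (word x n) (word y n)"

definition diag_event ::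
  "'w measure \<Rightarrow> (nat \<Rightarrow> 'w \<Rightarrow> 'a) \<Rightarrow> (nat \<Rightarrow> 'w \<Rightarrow> 'a) \<Rightarrow> nat \<Rightarrow> nat \<Rightarrow> real \<Rightarrow> real \<Rightarrow> real \<Rightarrow> 'w set" where
  "diag_event M X Y n k \<epsilon> p1 p2 =
     {\<omega> \<in> space M. \<forall>S. optimal_alignment (\<lambda>i. X i \<omega>) (\<lambda>j. Y j \<omega>) n S \<longrightarrow>
        (\<forall>(x, y)\<in>S. real y \<ge> p1 * real x - p1 * real n * \<epsilon> - p1 * real k \<and>
                     real y \<le> p2 * real x + p2 * real n * \<epsilon> + p2 * real k)}"

end

theory Submission imports Defs "HOL-Real_Asymp.Real_Asymp"
begin

text \<open>
  If an optimal alignment contains a point \<open>(x, y)\<close>, then \<open>LC\<^sub>n\<close> splits at that point: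
  it equals \<open>|LCS(X\<^sub>1\<dots>X\<^sub>x; Y\<^sub>1\<dots>Y\<^sub>y)|\<close> plus the LCS length of the two remaining words.
  When \<open>(x, y)\<close> lies below the lower line, \<open>y \<le> p\<^sub>1 x\<close> and \<open>x \<ge> \<epsilon>n\<close>, so the split sum has expectation
  at most \<open>\<gamma>\<^sup>* n - (\<gamma>\<^sup>* - \<gamma>(p\<^sub>1)) \<epsilon>n/2\<close>, where \<open>\<gamma>(p)\<close> stands for the constant of slope \<open>p\<close>;
  symmetrically above the upper line. The difference of the split sum and \<open>LC\<^sub>n\<close> changes by at most 2
  when one of the \<open>2n\<close> letters changes, so McDiarmid's inequality makes it nonnegative with probability at
  most \<open>exp (-\<kappa>\<^sup>2n/4)\<close> for some \<open>\<kappa> > \<delta>\<epsilon>/2\<close>, and the gap between \<open>\<kappa>\<close> and \<open>\<delta>\<epsilon>/2\<close> absorbs the union bound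
  over the \<open>(n+1)\<^sup>2\<close> possible points. Splitting at a single point, instead of into \<open>m\<close> blocks, even gives
  the bound without the entropy term \<open>(1 + ln k)/k\<close>.
\<close>

subsection \<open>Longest common subsequences and cuts\<close>

lemma finite_common_subseq_lengths: "finite {length z | z. subseq z x \<and> subseq z y}"
proof (rule finite_subset)
  show "{length z | z. subseq z x \<and> subseq z y} \<subseteq> {..length x}"
    by (auto dest: list_emb_length)
qed simp

lemma length_le_lcs_length:
  assumes "subseq z x" "subseq z y"
  shows "length z \<le> lcs_length x y"
  unfolding lcs_length_def
  by (rule Max_ge[OF finite_common_subseq_lengths]) (use assms in blast)

lemma lcs_length_witness:
  obtains z where "subseq z x" "subseq z y" "length z = lcs_length x y"
proof -
  have "lcs_length x y \<in> {length z | z. subseq z x \<and> subseq z y}"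
    unfolding lcs_length_def
    by (rule Max_in[OF finite_common_subseq_lengths]) (auto intro: exI[of _ "[]"])
  then show ?thesis using that by auto
qed

lemma lcs_length_commute: "lcs_length x y = lcs_length y x"
  unfolding lcs_length_def by (simp add: conj_commute)

lemma lcs_length_mono:
  assumes "subseq x x'" "subseq y y'"
  shows "lcs_length x y \<le> lcs_length x' y'"
  by (metis assms lcs_length_witness length_le_lcs_length subseq_order.trans)

lemma lcs_length_append:
  "lcs_length x y + lcs_length x' y' \<le> lcs_length (x @ x') (y @ y')"
proof -
  obtain z where z: "subseq z x" "subseq z y" "length z = lcs_length x y"
    by (rule lcs_length_witness)
  obtain z' where z': "subseq z' x'" "subseq z' y'" "length z' = lcs_length x' y'"
    by (rule lcs_length_witness)
  show ?thesis
    using length_le_lcs_length[of "z @ z'" "x @ x'" "y @ y'"] z z'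
    by (simp add: list_emb_append_mono)
qed

text \<open>Split a longest common subsequence into a piece inside \<open>u\<close> and a piece
  inside \<open>a # v\<close>. If the second piece does not embed into \<open>v\<close>, its head is
  matched to \<open>a\<close>, and dropping that head costs one letter.\<close>

lemma lcs_length_insert:
  "lcs_length (u @ a # v) y \<le> lcs_length (u @ v) y + 1"
proof -
  obtain z where z: "subseq z (u @ a # v)" "subseq z y" "length z = lcs_length (u @ a # v) y"
    by (rule lcs_length_witness)
  obtain z1 z2 where z12: "z = z1 @ z2" "subseq z1 u" "subseq z2 (a # v)"
    using z(1) by (auto simp: subseq_append_iff)
  define z2' where "z2' = (if subseq z2 v then z2 else tl z2)"
  have "subseq z2' v"
    using z12(3) unfolding z2'_def by (cases z2) (auto split: if_splits)
  moreover have "subseq z2' z2"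
    unfolding z2'_def by (cases z2) auto
  moreover have "length z2 \<le> length z2' + 1"
    unfolding z2'_def by auto
  moreover from calculation have "subseq (z1 @ z2') y"
    using z(2) z12(1) by (meson list_emb_append_mono subseq_order.refl subseq_order.trans)
  ultimately have "length (z1 @ z2') \<le> lcs_length (u @ v) y" "length z \<le> length (z1 @ z2') + 1"
    using z12 by (auto intro!: length_le_lcs_length list_emb_append_mono simp del: length_append) simp
  then show ?thesis using z(3) by linarith
qed

lemma lcs_length_snoc: "lcs_length u (v @ [a]) \<le> lcs_length u v + 1"
  using lcs_length_insert[of v a "[]" u] by (simp add: lcs_length_commute)

text \<open>For \<open>i\<close> in range, both \<open>u\<close> and its update arise from the same
  shorter word by inserting one letter at position \<open>i\<close>; otherwise the update changes
  nothing.\<close>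

lemma lcs_length_update: "lcs_length (u[i := a]) v \<le> lcs_length u v + 1"
proof (cases "i < length u")
  case True
  have "lcs_length (u[i := a]) v \<le> lcs_length (take i u @ drop (Suc i) u) v + 1"
    using True lcs_length_insert[of "take i u" a "drop (Suc i) u" v]
    by (simp add: upd_conv_take_nth_drop)
  also have "subseq (take i u @ drop (Suc i) u) u"
    using True by (subst (3) id_take_nth_drop[OF True]) (simp only: subseq_append' list_emb_Cons)
  then have "lcs_length (take i u @ drop (Suc i) u) v \<le> lcs_length u v"
    by (intro lcs_length_mono) auto
  finally show ?thesis by simp
qed (simp add: list_update_beyond)

section \<open>Alignments forced through a given point\<close>

definition cut_lcs :: "nat \<Rightarrow> nat \<Rightarrow> 'a list \<Rightarrow> 'a list \<Rightarrow> nat" where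
  "cut_lcs x y u v = lcs_length (take x u) (take y v) + lcs_length (drop x u) (drop y v)"

lemma cut_lcs_commute: "cut_lcs x y u v = cut_lcs y x v u"
  unfolding cut_lcs_def by (simp add: lcs_length_commute)

text \<open>The changed position lies in only one of the two pieces of \<open>u\<close>, so only one
  summand moves.\<close>

lemma cut_lcs_update: "cut_lcs x y (u[i := a]) v \<le> cut_lcs x y u v + 1"
proof (cases "i < x")
  case True
  then show ?thesis
    using lcs_length_update[of "take x u" i a "take y v"]
    by (simp add: cut_lcs_def take_update_swap)
next
  case False
  then show ?thesis
    using lcs_length_update[of "drop x u" "i - x" a "drop y v"]
    by (simp add: cut_lcs_def drop_update_swap)
qed

text \<open>Minus the loss incurred by forcing the alignment through \<open>(x, y)\<close>. By
  \<open>cut_lcs_le\<close> it is never positive, and it is zero exactly when some longest common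
  subsequence respects the cut.\<close>

definition cut_gap :: "nat \<Rightarrow> nat \<Rightarrow> 'a list \<Rightarrow> 'a list \<Rightarrow> real" where
  "cut_gap x y u v = real (cut_lcs x y u v) - real (lcs_length u v)"

lemma cut_gap_commute: "cut_gap x y u v = cut_gap y x v u"
  unfolding cut_gap_def by (metis cut_lcs_commute lcs_length_commute)

lemma cut_gap_update: "cut_gap x y (u[i := a]) v \<le> cut_gap x y u v + 2"
proof -
  \<comment> \<open>The subtracted length needs the opposite inequality, obtained by undoing the
    update, that is, writing \<open>u ! i\<close> back.\<close>
  have "lcs_length u v \<le> lcs_length (u[i := a]) v + 1"
    using lcs_length_update[of "u[i := a]" i "u ! i" v] by simp
  then show ?thesis
    using cut_lcs_update[of x y u i a v] unfolding cut_gap_def by linarith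
qed

text \<open>Storing both words in one list \<open>z\<close> puts the gap in the form required by a
  bounded-differences inequality for a single iid list, with constant 2.\<close>

lemma cut_gap_take_drop_update:
  "cut_gap x y (take n (z[i := a])) (drop n (z[i := a])) \<le> cut_gap x y (take n z) (drop n z) + 2"
proof (cases "i < n")
  case True
  then show ?thesis using cut_gap_update by (simp add: take_update_swap)
next
  case False
  then show ?thesis
    using cut_gap_update[of y x "drop n z" "i - n" a "take n z"]
    by (simp add: drop_update_swap cut_gap_commute[of x y])
qed

text \<open>Both coordinates increase strictly, so the pairs up to and including
  \<open>(x, y)\<close> match prefix with prefix, and all later pairs match suffix with suffix. Each
  group spells out a common subsequence of its two pieces.\<close>

lemma alignment_cut:
  assumes S: "alignment f g n S" and xy: "(x, y) \<in> S"
  shows "card S \<le> cut_lcs x y (word f n) (word g n)" "x \<in> {1..n}" "y \<in> {1..n}"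
proof -
  from S obtain l :: nat and i j :: "nat \<Rightarrow> nat" where S_eq: "S = (\<lambda>s. (i s, j s)) ` {1..l}"
    and mono: "strict_mono_on {1..l} i" "strict_mono_on {1..l} j"
    and match: "\<forall>s\<in>{1..l}. i s \<in> {1..n} \<and> j s \<in> {1..n} \<and> f (i s) = g (j s)"
    unfolding alignment_def by (elim exE conjE) (rule that)
  obtain t where t: "t \<in> {1..l}" "x = i t" "y = j t"
    using xy S_eq by auto
  show xn: "x \<in> {1..n}" and yn: "y \<in> {1..n}" using t match by auto
  \<comment> \<open>Strictly increasing indices with values in the interval from \<open>c\<close> to
    \<open>d\<close> form a subsequence of \<open>[c..<d]\<close>; mapping the letters over both
    lists then gives subsequences of words.\<close>
  have sub: "subseq (map h [a..<b]) [c..<d]"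
    if "strict_mono_on {1..l} h" "1 \<le> a" "b \<le> Suc l" "\<And>s. a \<le> s \<Longrightarrow> s < b \<Longrightarrow> c \<le> h s \<and> h s < d"
    for h :: "nat \<Rightarrow> nat" and a b c d
  proof -
    have "sorted_wrt (<) (map h [a..<b])"
      unfolding sorted_wrt_map
      by (rule sorted_wrt_mono_rel[OF _ sorted_wrt_upt])
         (use that in \<open>auto simp: strict_mono_on_def\<close>)
    then show ?thesis
      using that(4) by (intro sorted_subset_imp_subseq) (auto simp: strict_sorted_iff)
  qed
  have take_w: "take z (word h n) = map h [1..<Suc z]" if "z \<in> {1..n}" for h :: "nat \<Rightarrow> 'a" and z
    using that take_upt[of 1 z "Suc n"] by (simp only: word_def take_map) simp
  have drop_w: "drop z (word h n) = map h [Suc z..<Suc n]" for h :: "nat \<Rightarrow> 'a" and z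
    by (simp add: word_def drop_map del: upt_Suc)
  have less: "i s < i s' \<and> j s < j s'" if "1 \<le> s" "s < s'" "s' \<le> l" for s s'
    using that strict_mono_onD[OF mono(1), of s s'] strict_mono_onD[OF mono(2), of s s'] by simp
  have le: "i s \<le> i t \<and> j s \<le> j t" if "1 \<le> s" "s \<le> t" for s
    using that t(1) less[of s t] by (cases "s = t") auto
  have gt: "i t < i s \<and> j t < j s" if "t < s" "s \<le> l" for s
    using that t(1) less[of t s] by simp
  have eq: "map (g \<circ> j) [a..<b] = map (f \<circ> i) [a..<b]" if "1 \<le> a" "b \<le> Suc l" for a b
    using that match by auto
  have eq_t: "map (g \<circ> j) [1..<Suc t] = map (f \<circ> i) [1..<Suc t]"
    by (rule eq) (use t in auto)
  have eq_l: "map (g \<circ> j) [Suc t..<Suc l] = map (f \<circ> i) [Suc t..<Suc l]"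
    by (rule eq) auto
  have range: "1 \<le> i s \<and> i s \<le> n" "1 \<le> j s \<and> j s \<le> n" if "1 \<le> s" "s \<le> l" for s
    using that match by auto
  have "t = length (map (f \<circ> i) [1..<Suc t])" by simp
  also have "\<dots> \<le> lcs_length (take x (word f n)) (take y (word g n))"
  proof (rule length_le_lcs_length)
    have "subseq (map i [1..<Suc t]) [1..<Suc x]"
      by (rule sub[OF mono(1)]) (use le range t in \<open>auto simp: less_Suc_eq_le\<close>)
    from subseq_map[OF this, of f]
    show "subseq (map (f \<circ> i) [1..<Suc t]) (take x (word f n))"
      by (simp only: take_w[OF xn] map_map)
    have "subseq (map j [1..<Suc t]) [1..<Suc y]"
      by (rule sub[OF mono(2)]) (use le range t in \<open>auto simp: less_Suc_eq_le\<close>)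
    from subseq_map[OF this, of g]
    show "subseq (map (f \<circ> i) [1..<Suc t]) (take y (word g n))"
      by (simp only: take_w[OF yn] map_map eq_t)
  qed
  finally have A: "t \<le> lcs_length (take x (word f n)) (take y (word g n))" .
  have "l - t = length (map (f \<circ> i) [Suc t..<Suc l])" by (simp del: upt_Suc)
  also have "\<dots> \<le> lcs_length (drop x (word f n)) (drop y (word g n))"
  proof (rule length_le_lcs_length)
    have "subseq (map i [Suc t..<Suc l]) [Suc x..<Suc n]"
      by (rule sub[OF mono(1)]) (use gt range t in \<open>auto simp: less_Suc_eq_le Suc_le_eq\<close>)
    from subseq_map[OF this, of f]
    show "subseq (map (f \<circ> i) [Suc t..<Suc l]) (drop x (word f n))"
      by (simp only: drop_w map_map)
    have "subseq (map j [Suc t..<Suc l]) [Suc y..<Suc n]"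
      by (rule sub[OF mono(2)]) (use gt range t in \<open>auto simp: less_Suc_eq_le Suc_le_eq\<close>)
    from subseq_map[OF this, of g]
    show "subseq (map (f \<circ> i) [Suc t..<Suc l]) (drop y (word g n))"
      by (simp only: drop_w map_map eq_l)
  qed
  finally have B: "l - t \<le> lcs_length (drop x (word f n)) (drop y (word g n))" .
  have "card S \<le> l"
    using card_image_le[of "{1..l}" "\<lambda>s. (i s, j s)"] S_eq by simp
  then show "card S \<le> cut_lcs x y (word f n) (word g n)"
    using A B t unfolding cut_lcs_def by simp
qed

subsection \<open>Bounded differences for iid words\<close>

text \<open>Finite support makes every real function of an iid word integrable and turns its
  expectation into a finite sum.\<close>

lemma finite_set_replicate_pmf:
  "finite (set_pmf p) \<Longrightarrow> finite (set_pmf (replicate_pmf n p))"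
  using finite_lists_length_eq[of "set_pmf p" n] unfolding set_replicate_pmf
  by (simp add: lists_eq_set conj_commute)

lemma expectation_bind_pmf:
  fixes h :: "'b \<Rightarrow> real"
  assumes "finite (set_pmf p)" "\<And>x. x \<in> set_pmf p \<Longrightarrow> finite (set_pmf (f x))"
  shows "measure_pmf.expectation (bind_pmf p f) h =
    measure_pmf.expectation p (\<lambda>x. measure_pmf.expectation (f x) h)"
  using assms
  by (simp add: pmf_expectation_bind[of "set_pmf p"] integral_measure_pmf[of "set_pmf p"])

lemma expectation_replicate_pmf_Suc:
  fixes h :: "'a list \<Rightarrow> real"
  assumes "finite (set_pmf p)"
  shows "measure_pmf.expectation (replicate_pmf (Suc n) p) h =
    measure_pmf.expectation p (\<lambda>x. measure_pmf.expectation (replicate_pmf n p) (\<lambda>xs. h (x # xs)))"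
  using assms
  by (simp add: expectation_bind_pmf finite_set_replicate_pmf flip: map_pmf_def)

lemma expectation_mono_pmf:
  fixes f g :: "'b \<Rightarrow> real"
  assumes "finite (set_pmf p)" "\<And>x. x \<in> set_pmf p \<Longrightarrow> f x \<le> g x"
  shows "measure_pmf.expectation p f \<le> measure_pmf.expectation p g"
  using assms by (intro integral_mono_AE) (auto simp: integrable_measure_pmf_finite AE_measure_pmf_iff)

lemma expectation_cong_pmf:
  assumes "\<And>x. x \<in> set_pmf p \<Longrightarrow> f x = g x"
  shows "measure_pmf.expectation p f = measure_pmf.expectation p g"
  using assms by (intro integral_cong_AE) (auto simp: AE_measure_pmf_iff)

lemma expectation_replicate_pmf_add:
  fixes h :: "'a list \<Rightarrow> real"
  assumes "finite (set_pmf p)"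
  shows "measure_pmf.expectation (replicate_pmf (m + n) p) h =
    measure_pmf.expectation (replicate_pmf m p)
      (\<lambda>u. measure_pmf.expectation (replicate_pmf n p) (\<lambda>v. h (u @ v)))"
  unfolding replicate_pmf_distrib using assms
  by (simp add: expectation_bind_pmf finite_set_replicate_pmf flip: map_pmf_def)

text \<open>Oscillation at most \<open>c\<close> confines \<open>g\<close> on the support to an
  interval of length \<open>c\<close> that starts at its minimum, where Hoeffding's lemma applies.
  The hypothesis has the form that bounded differences deliver.\<close>

lemma Hoeffdings_lemma_oscillation:
  fixes g :: "'b \<Rightarrow> real"
  assumes fin: "finite (set_pmf p)" and s: "0 < s"
    and osc: "\<And>x y. x \<in> set_pmf p \<Longrightarrow> y \<in> set_pmf p \<Longrightarrow> g x \<le> g y + c"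
  shows "measure_pmf.expectation p (\<lambda>x. exp (s * (g x - measure_pmf.expectation p g)))
    \<le> exp (s\<^sup>2 * c\<^sup>2 / 8)"
proof -
  define a where "a = Min (g ` set_pmf p)"
  have ne: "g ` set_pmf p \<noteq> {}" by (simp add: set_pmf_not_empty)
  have "a \<in> g ` set_pmf p"
    unfolding a_def using fin ne by (intro Min_in) auto
  then obtain y where y: "y \<in> set_pmf p" "a = g y" by auto
  interpret interval_bounded_random_variable "measure_pmf p" g a "a + c"
  proof unfold_locales
    have "a \<le> g x" if "x \<in> set_pmf p" for x
      unfolding a_def using fin that by simp
    then show "AE x in measure_pmf p. g x \<in> {a..a + c}"
      using osc[OF _ y(1)] y(2) by (auto simp: AE_measure_pmf_iff)
  qed simp
  have "ennreal (measure_pmf.expectation p (\<lambda>x. exp (s * (g x - measure_pmf.expectation p g))))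
      = (\<integral>\<^sup>+x. ennreal (exp (s * (g x - measure_pmf.expectation p g))) \<partial>measure_pmf p)"
    by (rule nn_integral_eq_integral[symmetric]) (auto simp: fin integrable_measure_pmf_finite)
  also have "\<dots> \<le> ennreal (exp (s\<^sup>2 * (a + c - a)\<^sup>2 / 8))"
    by (rule Hoeffdings_lemma_nn_integral[OF s])
  finally show ?thesis by (simp add: ennreal_le_iff)
qed

text \<open>The martingale argument as an induction on the length: \<open>g x\<close> is the
  conditional mean of \<open>f\<close> given the first letter \<open>x\<close>. The fluctuation of
  \<open>f\<close> around \<open>g x\<close> is controlled by the induction hypothesis uniformly in
  \<open>x\<close>, that of \<open>g\<close> around its mean by Hoeffding's lemma.\<close>

lemma mgf_bounded_differences:
  fixes f :: "'a list \<Rightarrow> real"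
  assumes fin: "finite (set_pmf p)" and s: "0 < s"
    and diff: "\<And>xs i a. f (xs[i := a]) \<le> f xs + c"
  shows "measure_pmf.expectation (replicate_pmf n p)
      (\<lambda>xs. exp (s * (f xs - measure_pmf.expectation (replicate_pmf n p) f)))
    \<le> exp (real n * (s\<^sup>2 * c\<^sup>2 / 8))"
  using diff
proof (induction n arbitrary: f)
  case 0
  then show ?case by simp
next
  case (Suc n)
  let ?E = "measure_pmf.expectation (replicate_pmf n p)"
  define g where "g x = ?E (\<lambda>xs. f (x # xs))" for x
  let ?m = "measure_pmf.expectation p g"
  have finn: "finite (set_pmf (replicate_pmf n p))"
    by (rule finite_set_replicate_pmf[OF fin])
  have mean: "measure_pmf.expectation (replicate_pmf (Suc n) p) f = ?m"
    unfolding g_def by (rule expectation_replicate_pmf_Suc[OF fin])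
  have tail: "?E (\<lambda>xs. exp (s * (f (x # xs) - g x))) \<le> exp (real n * (s\<^sup>2 * c\<^sup>2 / 8))" for x
    unfolding g_def
  proof (rule Suc.IH)
    show "f (x # xs[i := a]) \<le> f (x # xs) + c" for xs i a
      using Suc.prems[of "x # xs" "Suc i" a] by simp
  qed
  \<comment> \<open>Changing the first letter is an update at position 0, so the difference bound
    survives averaging over the tail.\<close>
  have osc: "g x \<le> g y + c" for x y
  proof -
    have "g x \<le> ?E (\<lambda>xs. f (y # xs) + c)"
      unfolding g_def using Suc.prems[of "y # _" 0 x]
      by (intro expectation_mono_pmf[OF finn]) simp
    also have "\<dots> = g y + c"
      unfolding g_def by (simp add: integrable_measure_pmf_finite[OF finn])
    finally show ?thesis .
  qed
  have "measure_pmf.expectation (replicate_pmf (Suc n) p) (\<lambda>xs. exp (s * (f xs - ?m)))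
      = measure_pmf.expectation p (\<lambda>x. ?E (\<lambda>xs. exp (s * (f (x # xs) - ?m))))"
    by (rule expectation_replicate_pmf_Suc[OF fin])
  also have "\<dots> = measure_pmf.expectation p
      (\<lambda>x. exp (s * (g x - ?m)) * ?E (\<lambda>xs. exp (s * (f (x # xs) - g x))))"
    by (simp flip: exp_add integral_mult_right_zero add: algebra_simps)
  also have "\<dots> \<le> measure_pmf.expectation p
      (\<lambda>x. exp (s * (g x - ?m)) * exp (real n * (s\<^sup>2 * c\<^sup>2 / 8)))"
    by (intro expectation_mono_pmf[OF fin] mult_left_mono tail) auto
  also have "\<dots> = measure_pmf.expectation p (\<lambda>x. exp (s * (g x - ?m)))
      * exp (real n * (s\<^sup>2 * c\<^sup>2 / 8))"
    by simp
  also have "\<dots> \<le> exp (s\<^sup>2 * c\<^sup>2 / 8) * exp (real n * (s\<^sup>2 * c\<^sup>2 / 8))"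
    by (intro mult_right_mono Hoeffdings_lemma_oscillation[OF fin s] osc) auto
  also have "\<dots> = exp (real (Suc n) * (s\<^sup>2 * c\<^sup>2 / 8))"
    by (simp add: algebra_simps flip: exp_add)
  finally show ?case using mean by simp
qed

text \<open>The Chernoff parameter \<open>s = 4t/(n c\<^sup>2)\<close> minimises \<open>n s\<^sup>2 c\<^sup>2/8 - s t\<close>.\<close>

lemma McDiarmid_ineq:
  fixes f :: "'a list \<Rightarrow> real"
  assumes fin: "finite (set_pmf p)" and c: "0 < c" and n: "0 < n" and t: "0 < t"
    and diff: "\<And>xs i a. f (xs[i := a]) \<le> f xs + c"
  shows "measure_pmf.prob (replicate_pmf n p)
      {xs. measure_pmf.expectation (replicate_pmf n p) f + t \<le> f xs}
    \<le> exp (- 2 * t\<^sup>2 / (real n * c\<^sup>2))"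
proof -
  let ?P = "replicate_pmf n p"
  let ?m = "measure_pmf.expectation ?P f"
  define s where "s = 4 * t / (real n * c\<^sup>2)"
  have s: "0 < s" unfolding s_def using assms by simp
  have finn: "finite (set_pmf ?P)"
    by (rule finite_set_replicate_pmf[OF fin])
  have "{xs. ?m + t \<le> f xs} = {xs \<in> space (measure_pmf ?P). exp (s * t) \<le> exp (s * (f xs - ?m))}"
    using s by (auto simp: le_diff_eq add.commute)
  then have "measure_pmf.prob ?P {xs. ?m + t \<le> f xs}
      \<le> measure_pmf.expectation ?P (\<lambda>xs. exp (s * (f xs - ?m))) / exp (s * t)"
    using integral_Markov_inequality_measure[of "measure_pmf ?P" "\<lambda>xs. exp (s * (f xs - ?m))" "{}" "exp (s * t)"]
    by (simp add: integrable_measure_pmf_finite[OF finn])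
  also have "\<dots> \<le> exp (real n * (s\<^sup>2 * c\<^sup>2 / 8)) / exp (s * t)"
    by (intro divide_right_mono mgf_bounded_differences fin s diff) auto
  also have "\<dots> = exp (real n * (s\<^sup>2 * c\<^sup>2 / 8) - s * t)"
    by (simp add: exp_diff)
  also have "real n * (s\<^sup>2 * c\<^sup>2 / 8) - s * t = - 2 * t\<^sup>2 / (real n * c\<^sup>2)"
    unfolding s_def using n c by (simp add: field_simps power2_eq_square)
  finally show ?thesis .
qed

subsection \<open>Expected LCS length along a slope\<close>

text \<open>The limit is the supremum of the quotients. Writing \<open>n = q * N + r\<close> with
  \<open>r < N\<close> shows that the quotient at any fixed \<open>N\<close> is asymptotically a
  lower bound.\<close>

lemma Fekete_superadditive:
  fixes b :: "nat \<Rightarrow> real"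
  assumes super: "\<And>m n. b m + b n \<le> b (m + n)" and bound: "\<And>n. b n \<le> C * real n"
  shows "convergent (\<lambda>n. b n / real n)"
proof -
  define L where "L = (SUP n\<in>{1..}. b n / real n)"
  have bdd: "bdd_above ((\<lambda>n. b n / real n) ` {1..})"
  proof (rule bdd_aboveI2)
    show "b n / real n \<le> C" if "n \<in> {1..}" for n
      using bound[of n] that by (simp add: divide_le_eq)
  qed
  have upper: "b n / real n \<le> L" if "n \<ge> 1" for n
    unfolding L_def using that by (intro cSUP_upper bdd) auto
  have mult: "real q * b N + b r \<le> b (q * N + r)" for q N r
  proof (induction q)
    case (Suc q)
    then show ?case using super[of N "q * N + r"] by (simp add: algebra_simps)
  qed simp
  have "(\<lambda>n. b n / real n) \<longlonglongrightarrow> L"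
  proof (rule order_tendstoI)
    fix a assume "a < L"
    then obtain N where N: "N \<ge> 1" "a < b N / real N"
      unfolding L_def using less_cSUP_iff[OF _ bdd, of a] by auto
    \<comment> \<open>A lower bound for the remainder term \<open>b r\<close>, uniform over the
      finitely many \<open>r < N\<close>, so its contribution vanishes after division by
      \<open>n\<close>.\<close>
    define D where "D = Min (b ` {..<N})"
    have low: "b N / real N - (\<bar>b N\<bar> + \<bar>D\<bar>) / real n \<le> b n / real n" if "n \<ge> 1" for n
    proof -
      have "D \<le> b (n mod N)" unfolding D_def using N(1) by (intro Min_le) auto
      then have "real (n div N) * b N + D \<le> b n"
        using mult[of "n div N" N "n mod N"] by simp
      moreover have "real (n div N) = (real n - real (n mod N)) / real N"
        using N(1) by (subst div_mult_mod_eq[of n N, symmetric], subst of_nat_add) simp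
      moreover have "\<bar>real (n mod N) / real N * b N\<bar> \<le> 1 * \<bar>b N\<bar>"
        unfolding abs_mult using N(1) by (intro mult_right_mono) (auto simp: less_imp_le)
      ultimately have "real n * (b N / real N) - (\<bar>b N\<bar> + \<bar>D\<bar>) \<le> b n"
        by (simp add: diff_divide_distrib left_diff_distrib abs_if split: if_splits)
      then have "(real n * (b N / real N) - (\<bar>b N\<bar> + \<bar>D\<bar>)) / real n \<le> b n / real n"
        by (intro divide_right_mono) auto
      then show ?thesis using that by (simp add: diff_divide_distrib)
    qed
    have "(\<lambda>n. b N / real N - (\<bar>b N\<bar> + \<bar>D\<bar>) / real n) \<longlonglongrightarrow> b N / real N - 0"
      by (intro tendsto_diff tendsto_const lim_const_over_n)
    then have "\<forall>\<^sub>F n in sequentially. a < b N / real N - (\<bar>b N\<bar> + \<bar>D\<bar>) / real n"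
      using N(2) by (intro order_tendstoD(1)) auto
    then show "\<forall>\<^sub>F n in sequentially. a < b n / real n"
      using eventually_ge_at_top[of 1] by eventually_elim (use low in fastforce)
  next
    fix a assume "L < a"
    then show "\<forall>\<^sub>F n in sequentially. b n / real n < a"
      by (intro eventually_mono[OF eventually_ge_at_top[of 1]]) (use upper in \<open>blast intro: order.strict_trans1\<close>)
  qed
  then show ?thesis by (rule convergentI)
qed

text \<open>The expectation is taken over finite word laws instead of the original probability
  space; \<open>distr_word_pair\<close> later provides the transfer.\<close>

definition mean_lcs :: "'a pmf \<Rightarrow> nat \<Rightarrow> nat \<Rightarrow> real" where
  "mean_lcs p m n = measure_pmf.expectation (pair_pmf (replicate_pmf m p) (replicate_pmf n p))
     (\<lambda>(u, v). real (lcs_length u v))"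

lemma lcs_length_le: "lcs_length u v \<le> length u"
  by (metis lcs_length_witness list_emb_length)

lemma cut_lcs_le: "cut_lcs x y u v \<le> lcs_length u v"
  unfolding cut_lcs_def
  using lcs_length_append[of "take x u" "take y v" "drop x u" "drop y v"] by simp

lemma mean_lcs_commute: "mean_lcs p m n = mean_lcs p n m"
  unfolding mean_lcs_def
  by (subst pair_commute_pmf) (simp add: case_prod_unfold lcs_length_commute)

lemma mean_lcs_nonneg: "0 \<le> mean_lcs p m n"
  unfolding mean_lcs_def by (intro integral_nonneg_AE) (simp add: case_prod_beta)

text \<open>The sequence whose limit is \<open>gamma_tilde\<close>. For \<open>r = 1\<close> the
  denominator is \<open>real n\<close>, so the limit is \<open>gamma_star\<close>.\<close>

definition slope_mean :: "'a pmf \<Rightarrow> real \<Rightarrow> nat \<Rightarrow> real" where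
  "slope_mean p r n = mean_lcs p n (nat \<lceil>real n * r\<rceil>) / (real n * (1 + r) / 2)"

context
  fixes p :: "'a pmf"
  assumes fin: "finite (set_pmf p)"
begin

lemma finite_set_replicate: "finite (set_pmf (replicate_pmf n p))"
  by (rule finite_set_replicate_pmf[OF fin])

lemma integrable_replicate_pmf [simp]:
  "integrable (measure_pmf (replicate_pmf n p)) (f :: 'a list \<Rightarrow> real)"
  by (rule integrable_measure_pmf_finite[OF finite_set_replicate])

lemma mean_lcs_iterated:
  "mean_lcs p m n = measure_pmf.expectation (replicate_pmf m p)
     (\<lambda>u. measure_pmf.expectation (replicate_pmf n p) (\<lambda>v. real (lcs_length u v)))"
  unfolding mean_lcs_def pair_pmf_def
  by (simp add: expectation_bind_pmf finite_set_replicate)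

text \<open>The four pieces of the two words are independent iid words, so linearity leaves one mean
  for each pair of pieces.\<close>

lemma expectation_cut_lcs:
  assumes "x \<le> m" "y \<le> n"
  shows "measure_pmf.expectation (replicate_pmf m p)
     (\<lambda>u. measure_pmf.expectation (replicate_pmf n p) (\<lambda>v. real (cut_lcs x y u v)))
     = mean_lcs p x y + mean_lcs p (m - x) (n - y)"
proof -
  obtain m' n' where mn: "m = x + m'" "n = y + n'"
    using assms by (auto simp: le_iff_add)
  let ?E = "\<lambda>k. measure_pmf.expectation (replicate_pmf k p)"
  have "?E m (\<lambda>u. ?E n (\<lambda>v. real (cut_lcs x y u v)))
      = ?E x (\<lambda>u. ?E m' (\<lambda>u'. ?E y (\<lambda>v. ?E n' (\<lambda>v'. real (cut_lcs x y (u @ u') (v @ v'))))))"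
    unfolding mn by (simp add: expectation_replicate_pmf_add[OF fin])
  also have "\<dots> = ?E x (\<lambda>u. ?E m' (\<lambda>u'. ?E y (\<lambda>v. ?E n' (\<lambda>v'.
      real (lcs_length u v) + real (lcs_length u' v')))))"
    by (intro expectation_cong_pmf) (auto simp: set_replicate_pmf cut_lcs_def)
  also have "\<dots> = mean_lcs p x y + mean_lcs p m' n'"
    by (simp add: mean_lcs_iterated)
  finally show ?thesis by (simp add: mn)
qed

lemma mean_lcs_superadditive:
  "mean_lcs p m n + mean_lcs p m' n' \<le> mean_lcs p (m + m') (n + n')"
  using expectation_cut_lcs[of m "m + m'" n "n + n'"]
    expectation_mono_pmf[OF finite_set_replicate, of "m + m'"
      "\<lambda>u. measure_pmf.expectation (replicate_pmf (n + n') p) (\<lambda>v. real (cut_lcs m n u v))"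
      "\<lambda>u. measure_pmf.expectation (replicate_pmf (n + n') p) (\<lambda>v. real (lcs_length u v))"]
  by (simp add: mean_lcs_iterated expectation_mono_pmf[OF finite_set_replicate] cut_lcs_le)

lemma mean_lcs_mono:
  assumes "m \<le> m'" "n \<le> n'"
  shows "mean_lcs p m n \<le> mean_lcs p m' n'"
  using mean_lcs_superadditive[of m n "m' - m" "n' - n"] mean_lcs_nonneg[of p "m' - m" "n' - n"] assms
  by simp

text \<open>This pays for rounding: one extra letter changes the mean by at most 1.\<close>

lemma mean_lcs_Suc: "mean_lcs p m (Suc n) \<le> mean_lcs p m n + 1"
proof -
  let ?E = "\<lambda>k. measure_pmf.expectation (replicate_pmf k p)"
  have "mean_lcs p m (Suc n) = ?E m (\<lambda>u. ?E n (\<lambda>v. ?E 1 (\<lambda>w. real (lcs_length u (v @ w)))))"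
    using expectation_replicate_pmf_add[OF fin, of n 1] by (simp add: mean_lcs_iterated)
  also have "\<dots> \<le> ?E m (\<lambda>u. ?E n (\<lambda>v. ?E 1 (\<lambda>w. real (lcs_length u v) + 1)))"
  proof (intro expectation_mono_pmf[OF finite_set_replicate])
    fix u v w assume "w \<in> set_pmf (replicate_pmf 1 p)"
    then obtain a where "w = [a]" by (auto simp: set_replicate_pmf length_Suc_conv)
    then show "real (lcs_length u (v @ w)) \<le> real (lcs_length u v) + 1"
      using lcs_length_snoc[of u v a] by simp
  qed
  also have "\<dots> = mean_lcs p m n + 1"
    by (simp add: mean_lcs_iterated)
  finally show ?thesis .
qed

lemma mean_lcs_le: "mean_lcs p m n \<le> real m"
proof -
  let ?E = "\<lambda>k. measure_pmf.expectation (replicate_pmf k p)"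
  have "mean_lcs p m n \<le> ?E m (\<lambda>u. ?E n (\<lambda>v. real m))"
    unfolding mean_lcs_iterated
  proof (intro expectation_mono_pmf[OF finite_set_replicate])
    fix u v assume "u \<in> set_pmf (replicate_pmf m p)"
    then show "real (lcs_length u v) \<le> real m"
      using lcs_length_le[of u v] by (auto simp: set_replicate_pmf)
  qed
  then show ?thesis by simp
qed

lemma mean_lcs_mult: "real k * mean_lcs p m n \<le> mean_lcs p (k * m) (k * n)"
proof (induction k)
  case (Suc k)
  then show ?case using mean_lcs_superadditive[of m n "k * m" "k * n"] by (simp add: algebra_simps)
qed (simp add: mean_lcs_nonneg)

text \<open>Two rounded lengths add up to at most one letter more than the rounded total, so the
  means are superadditive up to an error of 1. Subtracting 1 from each mean absorbs the error, and
  Fekete's lemma applies.\<close>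

lemma convergent_slope_mean:
  assumes "r > 0"
  shows "convergent (slope_mean p r)"
proof -
  let ?c = "\<lambda>n. nat \<lceil>real n * r\<rceil>"
  define b where "b n = mean_lcs p n (?c n) - 1" for n
  have "convergent (\<lambda>n. b n / real n)"
  proof (rule Fekete_superadditive)
    fix m n
    have nonneg: "0 \<le> \<lceil>real k * r\<rceil>" for k :: nat
    proof -
      have "0 \<le> real k * r" using assms by simp
      then show ?thesis by linarith
    qed
    have "\<lceil>real m * r\<rceil> + \<lceil>real n * r\<rceil> \<le> \<lceil>real (m + n) * r\<rceil> + 1"
      by (simp add: algebra_simps) linarith
    then have "?c m + ?c n \<le> Suc (?c (m + n))"
      using nonneg[of m] nonneg[of n] nonneg[of "m + n"] by linarith
    then have "mean_lcs p (m + n) (?c m + ?c n) \<le> mean_lcs p (m + n) (?c (m + n)) + 1"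
      by (meson mean_lcs_Suc mean_lcs_mono order.refl order.trans)
    then show "b m + b n \<le> b (m + n)"
      using mean_lcs_superadditive[of m "?c m" n "?c n"] unfolding b_def by linarith
  next
    show "b n \<le> 1 * real n" for n
      using mean_lcs_le[of n "?c n"] unfolding b_def by simp
  qed
  then obtain L where "(\<lambda>n. b n / real n) \<longlonglongrightarrow> L" by (auto simp: convergent_def)
  then have "(\<lambda>n. (b n / real n + 1 / real n) * (2 / (1 + r))) \<longlonglongrightarrow> (L + 0) * (2 / (1 + r))"
    by (intro tendsto_mult tendsto_add tendsto_const lim_const_over_n)
  \<comment> \<open>The identity includes \<open>n = 0\<close>, where both sides are 0 because
    division by zero yields 0.\<close>
  also have "(\<lambda>n. (b n / real n + 1 / real n) * (2 / (1 + r))) = slope_mean p r"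
    using assms by (auto simp: b_def slope_mean_def fun_eq_iff simp flip: add_divide_distrib)
  finally show ?thesis by (rule convergentI)
qed

lemma slope_mean_LIMSEQ: "r > 0 \<Longrightarrow> slope_mean p r \<longlonglongrightarrow> lim (slope_mean p r)"
  using convergent_slope_mean by (simp add: convergent_LIMSEQ_iff)

text \<open>Concatenating \<open>\<alpha>\<close> blocks of shape \<open>(x, y)\<close> with about \<open>\<alpha>\<rho>\<close> blocks of the transposed
  shape \<open>(y, x)\<close> gives a pair of words of slope approximately \<open>r\<close>.\<close>

lemma mean_lcs_le_slope:
  assumes r: "r > 0" and \<rho>: "\<rho> \<ge> 0" and xy: "x + y > 0"
    and slope: "real y + \<rho> * real x = r * (real x + \<rho> * real y)"
  shows "mean_lcs p x y \<le> lim (slope_mean p r) * ((real x + real y) / 2)"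
proof -
  \<comment> \<open>Padding the first word by \<open>C\<close> letters raises the second length
    allowed by slope \<open>r\<close> by at least \<open>\<bar>real x - r * real y\<bar>\<close>,
    which compensates for rounding the number \<open>\<beta> \<alpha>\<close> of transposed
    blocks.\<close>
  define C where "C = nat \<lceil>\<bar>real x - r * real y\<bar> / r\<rceil>"
  define \<beta> where "\<beta> \<alpha> = nat \<lfloor>real \<alpha> * \<rho>\<rfloor>" for \<alpha> :: nat
  define u where "u \<alpha> = \<alpha> * x + \<beta> \<alpha> * y + C" for \<alpha>
  have C: "\<bar>real x - r * real y\<bar> \<le> r * real C"
    unfolding C_def using r real_nat_ceiling_ge[of "\<bar>real x - r * real y\<bar> / r"]
    by (simp only: divide_le_eq mult.commute[of r])
  have \<beta>: "real (\<beta> \<alpha>) \<le> real \<alpha> * \<rho>" "real \<alpha> * \<rho> - 1 \<le> real (\<beta> \<alpha>)" for \<alpha>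
  proof -
    have "0 \<le> real \<alpha> * \<rho>" using \<rho> by simp
    then show "real (\<beta> \<alpha>) \<le> real \<alpha> * \<rho>" "real \<alpha> * \<rho> - 1 \<le> real (\<beta> \<alpha>)"
      unfolding \<beta>_def by linarith+
  qed
  have lower: "real (\<alpha> + \<beta> \<alpha>) * mean_lcs p x y / (real (u \<alpha>) * (1 + r) / 2) \<le> slope_mean p r (u \<alpha>)" for \<alpha>
  proof -
    have "\<bar>real (\<beta> \<alpha>) - real \<alpha> * \<rho>\<bar> \<le> 1"
      using \<beta>[of \<alpha>] by linarith
    then have "\<bar>(real x - r * real y) * (real (\<beta> \<alpha>) - real \<alpha> * \<rho>)\<bar> \<le> \<bar>real x - r * real y\<bar> * 1"
      unfolding abs_mult by (intro mult_left_mono) auto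
    then have "(real x - r * real y) * (real (\<beta> \<alpha>) - real \<alpha> * \<rho>) \<le> \<bar>real x - r * real y\<bar>"
      by (metis abs_ge_self mult.right_neutral order.trans)
    \<comment> \<open>The last bracket vanishes by \<open>slope\<close>; what remains is the
      rounding error of \<open>\<beta> \<alpha>\<close>, at most 1, times a constant covered by
      \<open>C\<close>.\<close>
    moreover have "real (\<alpha> * y + \<beta> \<alpha> * x) - r * real (\<alpha> * x + \<beta> \<alpha> * y)
        = (real x - r * real y) * (real (\<beta> \<alpha>) - real \<alpha> * \<rho>)
          + real \<alpha> * (real y + \<rho> * real x - r * (real x + \<rho> * real y))"
      by (simp add: algebra_simps)
    ultimately have "real (\<alpha> * y + \<beta> \<alpha> * x) \<le> real (u \<alpha>) * r"
      using C slope unfolding u_def by (simp add: algebra_simps)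
    then have le: "\<alpha> * y + \<beta> \<alpha> * x \<le> nat \<lceil>real (u \<alpha>) * r\<rceil>"
      by linarith
    have "real (\<alpha> + \<beta> \<alpha>) * mean_lcs p x y
        = real \<alpha> * mean_lcs p x y + real (\<beta> \<alpha>) * mean_lcs p y x"
      by (simp add: algebra_simps mean_lcs_commute[of p y x])
    also have "\<dots> \<le> mean_lcs p (\<alpha> * x) (\<alpha> * y) + mean_lcs p (\<beta> \<alpha> * y) (\<beta> \<alpha> * x)"
      by (intro add_mono mean_lcs_mult)
    also have "\<dots> \<le> mean_lcs p (\<alpha> * x + \<beta> \<alpha> * y) (\<alpha> * y + \<beta> \<alpha> * x)"
      by (rule mean_lcs_superadditive)
    also have "\<dots> \<le> mean_lcs p (u \<alpha>) (nat \<lceil>real (u \<alpha>) * r\<rceil>)"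
      using le by (intro mean_lcs_mono) (auto simp: u_def)
    finally show ?thesis
      unfolding slope_mean_def using r by (intro divide_right_mono) auto
  qed
  have pos: "real x + \<rho> * real y > 0"
  proof -
    \<comment> \<open>Add \<open>real x + \<rho> * real y\<close> to both sides of
      \<open>slope\<close>: the total length of one block and \<rho> transposed blocks is counted in
      two ways.\<close>
    have "(1 + r) * (real x + \<rho> * real y) = (1 + \<rho>) * (real x + real y)"
      using slope by (simp add: algebra_simps)
    moreover have "(1 + \<rho>) * (real x + real y) > 0"
      using \<rho> xy by (intro mult_pos_pos) linarith+
    ultimately have "0 < (1 + r) * (real x + \<rho> * real y)" by linarith
    then show ?thesis by (rule zero_less_mult_pos) (use r in simp)
  qed
  have lim\<beta>: "(\<lambda>\<alpha>. real (\<beta> \<alpha>) / real \<alpha>) \<longlonglongrightarrow> \<rho>"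
  proof (rule real_tendsto_sandwich)
    show "\<forall>\<^sub>F \<alpha> in sequentially. \<rho> - 1 / real \<alpha> \<le> real (\<beta> \<alpha>) / real \<alpha>"
      using eventually_gt_at_top[of 0]
    proof eventually_elim
      case (elim \<alpha>)
      then show ?case
        using divide_right_mono[OF \<beta>(2)[of \<alpha>], of "real \<alpha>"] by (simp add: diff_divide_distrib)
    qed
    show "\<forall>\<^sub>F \<alpha> in sequentially. real (\<beta> \<alpha>) / real \<alpha> \<le> \<rho>"
      using eventually_gt_at_top[of 0]
      by eventually_elim (use \<beta> in \<open>simp add: field_simps\<close>)
    have "(\<lambda>\<alpha>. \<rho> - 1 / real \<alpha>) \<longlonglongrightarrow> \<rho> - 0"
      by (intro tendsto_diff tendsto_const lim_const_over_n)
    then show "(\<lambda>\<alpha>. \<rho> - 1 / real \<alpha>) \<longlonglongrightarrow> \<rho>" by simp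
  qed simp
  have limu: "(\<lambda>\<alpha>. real (u \<alpha>) / real \<alpha>) \<longlonglongrightarrow> real x + \<rho> * real y"
  proof (rule Lim_transform_eventually)
    have "(\<lambda>\<alpha>. real x + real (\<beta> \<alpha>) / real \<alpha> * real y + real C / real \<alpha>) \<longlonglongrightarrow> real x + \<rho> * real y + 0"
      by (intro tendsto_add tendsto_mult tendsto_const lim\<beta> lim_const_over_n)
    then show "(\<lambda>\<alpha>. real x + real (\<beta> \<alpha>) / real \<alpha> * real y + real C / real \<alpha>) \<longlonglongrightarrow> real x + \<rho> * real y"
      by simp
    show "\<forall>\<^sub>F \<alpha> in sequentially. real x + real (\<beta> \<alpha>) / real \<alpha> * real y + real C / real \<alpha> = real (u \<alpha>) / real \<alpha>"
      using eventually_gt_at_top[of 0] by eventually_elim (simp add: u_def field_simps)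
  qed
  \<comment> \<open>Since \<open>u \<alpha>\<close> grows linearly at a positive rate, the slope
    means along \<open>u\<close> have the limit of the full sequence.\<close>
  have u_div: "filterlim (\<lambda>\<alpha>. real (u \<alpha>) / real \<alpha> * real \<alpha>) at_top sequentially"
    by (rule filterlim_tendsto_pos_mult_at_top[OF limu pos filterlim_real_sequentially])
  have unscale: "\<forall>\<^sub>F \<alpha> in sequentially. real (u \<alpha>) / real \<alpha> * real \<alpha> = real (u \<alpha>)"
    using eventually_gt_at_top[of 0] by eventually_elim simp
  have "filterlim (\<lambda>\<alpha>. real (u \<alpha>)) at_top sequentially"
    by (rule iffD1[OF filterlim_cong[OF refl refl unscale] u_div])
  then have "filterlim u sequentially sequentially"
    by (simp add: filterlim_sequentially_iff_filterlim_real)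
  then have lim1: "(\<lambda>\<alpha>. slope_mean p r (u \<alpha>)) \<longlonglongrightarrow> lim (slope_mean p r)"
    by (rule filterlim_compose[OF slope_mean_LIMSEQ[OF r]])
  have "(\<lambda>\<alpha>. (1 + real (\<beta> \<alpha>) / real \<alpha>) * mean_lcs p x y / (real (u \<alpha>) / real \<alpha> * (1 + r) / 2))
      \<longlonglongrightarrow> (1 + \<rho>) * mean_lcs p x y / ((real x + \<rho> * real y) * (1 + r) / 2)"
    using pos r by (intro tendsto_intros lim\<beta> limu) auto
  moreover have "\<forall>\<^sub>F \<alpha> in sequentially.
      (1 + real (\<beta> \<alpha>) / real \<alpha>) * mean_lcs p x y / (real (u \<alpha>) / real \<alpha> * (1 + r) / 2)
      = real (\<alpha> + \<beta> \<alpha>) * mean_lcs p x y / (real (u \<alpha>) * (1 + r) / 2)"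
    using eventually_gt_at_top[of 0]
  proof eventually_elim
    case (elim \<alpha>)
    have "(1 + real (\<beta> \<alpha>) / real \<alpha>) * mean_lcs p x y / (real (u \<alpha>) / real \<alpha> * (1 + r) / 2)
        = (real \<alpha> * (1 + real (\<beta> \<alpha>) / real \<alpha>)) * mean_lcs p x y
          / ((real \<alpha> * (real (u \<alpha>) / real \<alpha>)) * (1 + r) / 2)"
      using elim by (simp add: mult.assoc)
    also have "real \<alpha> * (1 + real (\<beta> \<alpha>) / real \<alpha>) = real (\<alpha> + \<beta> \<alpha>)"
      using elim by (simp add: distrib_left)
    finally show ?case using elim by simp
  qed
  ultimately have lim2: "(\<lambda>\<alpha>. real (\<alpha> + \<beta> \<alpha>) * mean_lcs p x y / (real (u \<alpha>) * (1 + r) / 2))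
      \<longlonglongrightarrow> (1 + \<rho>) * mean_lcs p x y / ((real x + \<rho> * real y) * (1 + r) / 2)"
    by (rule Lim_transform_eventually)
  \<comment> \<open>Let \<alpha> tend to infinity in \<open>lower\<close>; by the letter count the
    factor \<open>1 + \<rho>\<close> then cancels.\<close>
  have "(1 + \<rho>) * mean_lcs p x y / ((real x + \<rho> * real y) * (1 + r) / 2) \<le> lim (slope_mean p r)"
    by (rule LIMSEQ_le[OF lim2 lim1]) (use lower in auto)
  moreover have "(real x + \<rho> * real y) * (1 + r) = (1 + \<rho>) * (real x + real y)"
    using slope by (simp add: algebra_simps)
  ultimately have "mean_lcs p x y / ((real x + real y) / 2) \<le> lim (slope_mean p r)"
    using \<rho> by (simp add: mult.assoc)
  then show ?thesis
    using xy by (simp add: divide_le_eq)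
qed

section \<open>Bounds for means on the diagonal and on either side of it\<close>

lemma mean_lcs_0: "mean_lcs p 0 n = 0"
  using mean_lcs_le[of 0 n] mean_lcs_nonneg[of p 0 n] by simp

text \<open>One block together with one transposed block is exactly square, whatever the
  shape.\<close>

lemma mean_lcs_le_diagonal:
  "mean_lcs p x y \<le> lim (slope_mean p 1) * ((real x + real y) / 2)"
proof (cases "x + y > 0")
  case True
  then show ?thesis by (intro mean_lcs_le_slope[where \<rho> = 1]) auto
qed (simp add: mean_lcs_0)

text \<open>The shape is at most as steep as \<open>r < 1\<close> while its transpose is steeper
  than \<open>r\<close>, so a nonnegative mixture has slope exactly \<open>r\<close>. Transposing
  changes neither the mean nor \<open>x + y\<close>.\<close>

lemma mean_lcs_le_below:
  assumes "0 < r" "r < 1" "real y \<le> r * real x"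
  shows "mean_lcs p x y \<le> lim (slope_mean p r) * ((real x + real y) / 2)"
proof (cases "x > 0")
  case True
  have "r * real y \<le> 1 * real y" "r * real x < 1 * real x"
    using assms True mult_right_mono[of r 1 "real y"] by auto
  then have "real x - r * real y > 0" using assms by linarith
  then show ?thesis
    \<comment> \<open>The ratio \<rho> is the solution of the linear equation \<open>slope\<close>;
      its numerator is nonnegative by the position of \<open>(x, y)\<close>.\<close>
    using assms True
    by (intro mean_lcs_le_slope[where \<rho> = "(r * real x - real y) / (real x - r * real y)"])
       (auto simp: field_simps)
qed (use assms in \<open>simp add: mean_lcs_0\<close>)

text \<open>The mirror image: the shape is at least as steep as \<open>r > 1\<close> and its
  transpose is flatter than \<open>r\<close>.\<close>

lemma mean_lcs_le_above:
  assumes "1 < r" "r * real x \<le> real y"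
  shows "mean_lcs p x y \<le> lim (slope_mean p r) * ((real x + real y) / 2)"
proof (cases "y > 0")
  case True
  have "real x \<le> r * real x" "real y < r * real y"
    using assms True by (auto simp: mult_le_cancel_right1)
  then have "r * real y - real x > 0" using assms by linarith
  then show ?thesis
    using assms True
    by (intro mean_lcs_le_slope[where \<rho> = "(real y - r * real x) / (r * real y - real x)"])
       (auto simp: field_simps)
qed (use assms in \<open>simp add: mean_lcs_0 mult_le_0_iff\<close>)

text \<open>The gap has mean at most \<open>- \<kappa> * real n\<close>, so being nonnegative is a
  deviation of \<open>\<kappa> * real n\<close>. McDiarmid's inequality with \<open>2 * n\<close>
  letters and constant 2 gives the exponent.\<close>

lemma prob_cut_gap_nonneg:
  assumes n: "n \<ge> 1" and xy: "x \<le> n" "y \<le> n" and \<kappa>: "\<kappa> > 0"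
    and mean: "mean_lcs p x y + mean_lcs p (n - x) (n - y) - mean_lcs p n n \<le> - \<kappa> * real n"
  shows "measure_pmf.prob (pair_pmf (replicate_pmf n p) (replicate_pmf n p))
      {(u, v). 0 \<le> cut_gap x y u v} \<le> exp (- (\<kappa>\<^sup>2 / 4 * real n))"
proof -
  let ?E = "\<lambda>k. measure_pmf.expectation (replicate_pmf k p)"
  let ?R = "replicate_pmf n p"
  let ?f = "\<lambda>z. cut_gap x y (take n z) (drop n z)"
  have "?E (n + n) ?f = ?E n (\<lambda>u. ?E n (\<lambda>v. ?f (u @ v)))"
    by (rule expectation_replicate_pmf_add[OF fin])
  also have "\<dots> = ?E n (\<lambda>u. ?E n (\<lambda>v. real (cut_lcs x y u v) - real (lcs_length u v)))"
    by (intro expectation_cong_pmf) (auto simp: set_replicate_pmf cut_gap_def)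
  also have "\<dots> = mean_lcs p x y + mean_lcs p (n - x) (n - y) - mean_lcs p n n"
    using expectation_cut_lcs[OF xy] by (simp add: mean_lcs_iterated)
  finally have E: "?E (n + n) ?f \<le> - \<kappa> * real n" using mean by simp
  have append: "replicate_pmf (n + n) p = map_pmf (\<lambda>(u, v). u @ v) (pair_pmf ?R ?R)"
    by (simp add: replicate_pmf_distrib pair_pmf_def map_pmf_def bind_assoc_pmf bind_return_pmf)
  have "measure_pmf.prob (pair_pmf ?R ?R) {(u, v). 0 \<le> cut_gap x y u v}
      = measure_pmf.prob (pair_pmf ?R ?R) ((\<lambda>(u, v). u @ v) -` {z. 0 \<le> ?f z})"
    \<comment> \<open>Splitting \<open>u @ v\<close> after \<open>n\<close> letters recovers
      \<open>u\<close> and \<open>v\<close> only when \<open>u\<close> has length \<open>n\<close>,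
      which holds almost surely.\<close>
    by (intro measure_pmf.finite_measure_eq_AE) (auto simp: AE_measure_pmf_iff set_replicate_pmf)
  also have "\<dots> = measure_pmf.prob (replicate_pmf (n + n) p) {z. 0 \<le> ?f z}"
    unfolding append by simp
  also have "\<dots> \<le> measure_pmf.prob (replicate_pmf (n + n) p) {z. ?E (n + n) ?f + \<kappa> * real n \<le> ?f z}"
    using E by (intro measure_pmf.finite_measure_mono) auto
  also have "\<dots> \<le> exp (- 2 * (\<kappa> * real n)\<^sup>2 / (real (n + n) * 2\<^sup>2))"
    using n \<kappa> cut_gap_take_drop_update by (intro McDiarmid_ineq fin) auto
  also have "- 2 * (\<kappa> * real n)\<^sup>2 / (real (n + n) * 2\<^sup>2) = - (\<kappa>\<^sup>2 / 4 * real n)"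
    using n by (simp add: field_simps power2_eq_square)
  finally show ?thesis .
qed

text \<open>Relative to the diagonal constant \<gamma>, the piece before the cut loses
  \<open>(\<gamma> - g) * (x + y) / 2\<close> in mean and the piece after it gains nothing. With
  \<open>x + y\<close> at least \<open>\<epsilon> * n\<close> this exceeds the finite-size error
  \<open>\<eta> * n\<close> by at least \<open>\<kappa> * n\<close>; a union bound over the cuts
  finishes.\<close>

lemma prob_some_cut_gap_nonneg:
  fixes \<epsilon> \<eta> g :: real
  defines "\<gamma> \<equiv> lim (slope_mean p 1)"
  assumes n: "n \<ge> 1" and diag: "mean_lcs p n n \<ge> (\<gamma> - \<eta>) * real n"
    and g: "g \<le> \<gamma>" and \<kappa>: "\<kappa> > 0" "\<kappa> \<le> (\<gamma> - g) * \<epsilon> / 2 - \<eta>"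
    and I: "I \<subseteq> {..n} \<times> {..n}" "\<And>x y. (x, y) \<in> I \<Longrightarrow> \<epsilon> * real n \<le> real x + real y"
      "\<And>x y. (x, y) \<in> I \<Longrightarrow> mean_lcs p x y \<le> g * ((real x + real y) / 2)"
  shows "measure_pmf.prob (pair_pmf (replicate_pmf n p) (replicate_pmf n p))
      {(u, v). \<exists>(x, y)\<in>I. 0 \<le> cut_gap x y u v} \<le> (real n + 1)\<^sup>2 * exp (- (\<kappa>\<^sup>2 / 4 * real n))"
proof -
  let ?R = "replicate_pmf n p"
  let ?A = "\<lambda>(x, y). {(u, v). 0 \<le> cut_gap x y u v}"
  have finI: "finite I" by (rule finite_subset[OF I(1)]) simp
  have "measure_pmf.prob (pair_pmf ?R ?R) (?A xy) \<le> exp (- (\<kappa>\<^sup>2 / 4 * real n))"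
    if "xy \<in> I" for xy
  proof -
    obtain x y where xy: "xy = (x, y)" by fastforce
    have le: "x \<le> n" "y \<le> n" using I(1) that xy by auto
    have "(\<gamma> - g) * (\<epsilon> * real n) \<le> (\<gamma> - g) * (real x + real y)"
      using I(2)[of x y] that xy g by (intro mult_left_mono) auto
    moreover have "\<kappa> * real n \<le> ((\<gamma> - g) * \<epsilon> / 2 - \<eta>) * real n"
      using \<kappa>(2) by (intro mult_right_mono) auto
    moreover have "mean_lcs p x y \<le> g * ((real x + real y) / 2)"
      using I(3) that xy by simp
    moreover have "mean_lcs p (n - x) (n - y) \<le> \<gamma> * ((2 * real n - (real x + real y)) / 2)"
      using mean_lcs_le_diagonal[of "n - x" "n - y"] le
      unfolding \<gamma>_def by (simp add: of_nat_diff algebra_simps)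
    ultimately have "mean_lcs p x y + mean_lcs p (n - x) (n - y) - mean_lcs p n n \<le> - \<kappa> * real n"
      using diag by (simp add: field_simps)
    then show ?thesis
      unfolding xy using prob_cut_gap_nonneg[OF n le \<kappa>(1)] by simp
  qed
  then have each: "(\<Sum>xy\<in>I. measure_pmf.prob (pair_pmf ?R ?R) (?A xy))
      \<le> real (card I) * exp (- (\<kappa>\<^sup>2 / 4 * real n))"
    by (rule sum_bounded_above)
  have "card I \<le> (n + 1) * (n + 1)"
    using card_mono[OF _ I(1)] by (simp add: card_cartesian_product)
  then have "real (card I) \<le> real ((n + 1) * (n + 1))" by (rule of_nat_mono)
  then have card: "real (card I) \<le> (real n + 1)\<^sup>2"
    by (simp add: power2_eq_square algebra_simps)
  have "measure_pmf.prob (pair_pmf ?R ?R) {(u, v). \<exists>(x, y)\<in>I. 0 \<le> cut_gap x y u v}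
      = measure_pmf.prob (pair_pmf ?R ?R) (\<Union>xy\<in>I. ?A xy)"
    by (rule arg_cong[where f = "measure_pmf.prob _"]) auto
  also have "\<dots> \<le> (\<Sum>xy\<in>I. measure_pmf.prob (pair_pmf ?R ?R) (?A xy))"
    by (intro measure_pmf.finite_measure_subadditive_finite finI) auto
  also note each
  also have "real (card I) * exp (- (\<kappa>\<^sup>2 / 4 * real n)) \<le> (real n + 1)\<^sup>2 * exp (- (\<kappa>\<^sup>2 / 4 * real n))"
    by (intro mult_right_mono card) auto
  finally show ?thesis .
qed

end

subsection \<open>Laws of the words\<close>

lemma pmf_replicate_pmf:
  "length xs = n \<Longrightarrow> pmf (replicate_pmf n p) xs = (\<Prod>i<n. pmf p (xs ! i))"
proof (induction n arbitrary: xs)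
  case (Suc n)
  obtain x xs' where xs: "xs = x # xs'" "length xs' = n"
    using Suc.prems by (auto simp: length_Suc_conv)
  have "replicate_pmf (Suc n) p = map_pmf (\<lambda>(x, xs). x # xs) (pair_pmf p (replicate_pmf n p))"
    by (simp add: pair_pmf_def map_pmf_def bind_assoc_pmf bind_return_pmf)
  moreover have "pmf (map_pmf (\<lambda>(x, xs). x # xs) (pair_pmf p (replicate_pmf n p))) (case (x, xs') of (x, xs) \<Rightarrow> x # xs)
      = pmf (pair_pmf p (replicate_pmf n p)) (x, xs')"
    by (rule pmf_map_inj') (auto intro!: injI)
  ultimately show ?case
    using Suc.IH[OF xs(2)] unfolding xs(1)
    by (simp add: pmf_pair prod.lessThan_Suc_shift del: replicate_pmf.simps prod.lessThan_Suc)
qed simp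

lemma length_word [simp]: "length (word x n) = n"
  by (simp add: word_def)

lemma word_eq_iff:
  "word x n = xs \<longleftrightarrow> length xs = n \<and> (\<forall>i\<in>{1..n}. x i = xs ! (i - 1))"
proof -
  have "word x n = xs \<longleftrightarrow> length xs = n \<and> (\<forall>i<n. x (Suc i) = xs ! i)"
    unfolding word_def by (auto simp: list_eq_iff_nth_eq simp del: upt_Suc)
  also have "(\<forall>i<n. x (Suc i) = xs ! i) \<longleftrightarrow> (\<forall>i\<in>{1..n}. x i = xs ! (i - 1))"
  proof (intro iffI ballI allI impI)
    fix i assume "\<forall>i<n. x (Suc i) = xs ! i" "i \<in> {1..n}"
    then show "x i = xs ! (i - 1)" by (auto dest!: spec[of _ "i - 1"])
  next
    fix i assume "\<forall>i\<in>{1..n}. x i = xs ! (i - 1)" "i < n"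
    then show "x (Suc i) = xs ! i" by (auto dest!: bspec[of _ _ "Suc i"])
  qed
  finally show ?thesis .
qed

lemma measurable_word:
  fixes X :: "nat \<Rightarrow> 'w \<Rightarrow> 'a::countable"
  assumes "\<And>i. i \<ge> 1 \<Longrightarrow> X i \<in> measurable M (count_space UNIV)"
  shows "(\<lambda>\<omega>. word (\<lambda>i. X i \<omega>) n) \<in> measurable M (count_space UNIV)"
proof -
  have "(\<lambda>\<omega>. word (\<lambda>i. X i \<omega>) n) -` {xs} \<inter> space M \<in> sets M" for xs
  proof -
    have "{\<omega> \<in> space M. \<forall>i\<in>{1..n}. X i \<omega> = xs ! (i - 1)} \<in> sets M"
    proof (rule sets.sets_Collect_finite_All)
      show "{\<omega> \<in> space M. X i \<omega> = xs ! (i - 1)} \<in> sets M" if "i \<in> {1..n}" for i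
        using measurable_sets[OF assms, of i "{xs ! (i - 1)}"] that
        by (simp add: vimage_def Int_def conj_commute)
    qed simp
    moreover have "(\<lambda>\<omega>. word (\<lambda>i. X i \<omega>) n) -` {xs} \<inter> space M
        = (if length xs = n then {\<omega> \<in> space M. \<forall>i\<in>{1..n}. X i \<omega> = xs ! (i - 1)} else {})"
      by (auto simp: word_eq_iff)
    ultimately show ?thesis by simp
  qed
  then show ?thesis by (simp add: measurable_count_space_eq_countable)
qed

context prob_space
begin

lemma prob_word_eq:
  fixes X :: "nat \<Rightarrow> 'a \<Rightarrow> 'b::countable"
  assumes indep: "indep_vars (\<lambda>_. count_space UNIV) X {1..}"
    and law: "\<And>i. i \<ge> 1 \<Longrightarrow> distr M (count_space UNIV) (X i) = measure_pmf p"
  shows "prob ((\<lambda>\<omega>. word (\<lambda>i. X i \<omega>) n) -` {xs} \<inter> space M) = pmf (replicate_pmf n p) xs"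
proof (cases "length xs = n")
  case True
  have rv: "X i \<in> measurable M (count_space UNIV)" if "i \<ge> 1" for i
    using indep that unfolding indep_vars_def by auto
  have single: "prob (X i -` {a} \<inter> space M) = pmf p a" if "i \<ge> 1" for i a
    using measure_distr[OF rv[OF that], of "{a}"] law[OF that] by (simp add: measure_pmf_single)
  show ?thesis
  \<comment> \<open>For \<open>n = 0\<close> the intersection over the empty index set would be
    \<open>UNIV\<close> instead of \<open>space M\<close>, and the product rule asks for a nonempty
    index set.\<close>
  proof (cases "n = 0")
    case True
    then show ?thesis using \<open>length xs = n\<close> by (simp add: word_def prob_space)
  next
    case False
    have "(\<lambda>\<omega>. word (\<lambda>i. X i \<omega>) n) -` {xs} \<inter> space M
        = (\<Inter>i\<in>{1..n}. X i -` {xs ! (i - 1)} \<inter> space M)"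
      using True False by (auto simp: word_eq_iff)
    also have "prob \<dots> = (\<Prod>i\<in>{1..n}. prob (X i -` {xs ! (i - 1)} \<inter> space M))"
      using False by (intro indep_varsD[OF indep]) auto
    also have "\<dots> = (\<Prod>i\<in>{1..n}. pmf p (xs ! (i - 1)))"
      by (intro prod.cong) (auto simp: single)
    also have "\<dots> = (\<Prod>i<n. pmf p (xs ! i))"
      by (rule prod.reindex_bij_witness[of _ Suc "\<lambda>i. i - 1"]) auto
    finally show ?thesis using True by (simp add: pmf_replicate_pmf)
  qed
next
  case False
  then have "xs \<notin> set_pmf (replicate_pmf n p)" by (simp add: set_replicate_pmf)
  moreover have "(\<lambda>\<omega>. word (\<lambda>i. X i \<omega>) n) -` {xs} \<inter> space M = {}"
    using False by (auto simp: word_eq_iff)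
  ultimately show ?thesis by (simp add: set_pmf_iff)
qed

text \<open>The two words are measurable functions of the two independent sequences, hence
  independent. Pairs of words form a countable type, so comparing point masses determines the
  law.\<close>

lemma distr_word_pair:
  fixes X Y :: "nat \<Rightarrow> 'a \<Rightarrow> 'b::countable"
  assumes X: "indep_vars (\<lambda>_. count_space UNIV) X {1..}"
    and Y: "indep_vars (\<lambda>_. count_space UNIV) Y {1..}"
    and XY: "indep_var (Pi\<^sub>M {1..} (\<lambda>_. count_space UNIV)) (\<lambda>\<omega>. \<lambda>i\<in>{1..}. X i \<omega>)
      (Pi\<^sub>M {1..} (\<lambda>_. count_space UNIV)) (\<lambda>\<omega>. \<lambda>j\<in>{1..}. Y j \<omega>)"
    and lawX: "\<And>i. i \<ge> 1 \<Longrightarrow> distr M (count_space UNIV) (X i) = measure_pmf p"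
    and lawY: "\<And>j. j \<ge> 1 \<Longrightarrow> distr M (count_space UNIV) (Y j) = measure_pmf q"
  defines "W \<equiv> \<lambda>m n \<omega>. (word (\<lambda>i. X i \<omega>) m, word (\<lambda>j. Y j \<omega>) n)"
  shows "W m n \<in> measurable M (count_space UNIV)"
    and "distr M (count_space UNIV) (W m n) = measure_pmf (pair_pmf (replicate_pmf m p) (replicate_pmf n q))"
proof -
  let ?P = "Pi\<^sub>M {1::nat..} (\<lambda>_. count_space (UNIV :: 'b set))"
  let ?wX = "\<lambda>\<omega>. word (\<lambda>i. X i \<omega>) m" and ?wY = "\<lambda>\<omega>. word (\<lambda>j. Y j \<omega>) n"
  have rvX: "X i \<in> measurable M (count_space UNIV)" and rvY: "Y i \<in> measurable M (count_space UNIV)"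
    if "i \<ge> 1" for i
    using X Y that unfolding indep_vars_def by auto
  have wX: "?wX \<in> measurable M (count_space UNIV)" and wY: "?wY \<in> measurable M (count_space UNIV)"
    by (auto intro!: measurable_word rvX rvY)
  have "(\<lambda>f. word f k) \<in> measurable ?P (count_space UNIV)" for k
    by (intro measurable_word measurable_component_singleton) auto
  from indep_var_compose[OF XY this[of m] this[of n]]
  have "indep_var (count_space UNIV) ((\<lambda>f. word f m) \<circ> (\<lambda>\<omega>. \<lambda>i\<in>{1..}. X i \<omega>))
      (count_space UNIV) ((\<lambda>f. word f n) \<circ> (\<lambda>\<omega>. \<lambda>j\<in>{1..}. Y j \<omega>))" .
  \<comment> \<open>Restricting a sequence to indices from 1 on does not affect its words, which
    never read index 0.\<close>
  also have "(\<lambda>f. word f m) \<circ> (\<lambda>\<omega>. \<lambda>i\<in>{1..}. X i \<omega>) = ?wX"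
    by (auto simp: word_def)
  also have "(\<lambda>f. word f n) \<circ> (\<lambda>\<omega>. \<lambda>j\<in>{1..}. Y j \<omega>) = ?wY"
    by (auto simp: word_def)
  finally have indep: "indep_var (count_space UNIV) ?wX (count_space UNIV) ?wY" .
  have vimage: "W m n -` {ab} \<inter> space M
      = (?wX -` {fst ab} \<inter> space M) \<inter> (?wY -` {snd ab} \<inter> space M)" for ab
    unfolding W_def by auto
  show meas: "W m n \<in> measurable M (count_space UNIV)"
    unfolding measurable_count_space_eq_countable[OF countableI_type] vimage
    using measurable_sets[OF wX] measurable_sets[OF wY] by (auto intro!: sets.Int)
  show "distr M (count_space UNIV) (W m n) = measure_pmf (pair_pmf (replicate_pmf m p) (replicate_pmf n q))"
  proof (rule measure_eqI_countable[where A = UNIV])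
    fix ab :: "'b list \<times> 'b list"
    have "prob (W m n -` {ab} \<inter> space M)
        = prob (?wX -` {fst ab} \<inter> space M) * prob (?wY -` {snd ab} \<inter> space M)"
      using indep_varD[OF indep, of "{fst ab}" "{snd ab}"] unfolding W_def by simp
    also have "\<dots> = pmf (pair_pmf (replicate_pmf m p) (replicate_pmf n q)) ab"
      using prob_word_eq[OF X lawX] prob_word_eq[OF Y lawY]
      by (cases ab) (simp add: pmf_pair)
    finally show "emeasure (distr M (count_space UNIV) (W m n)) {ab}
        = emeasure (measure_pmf (pair_pmf (replicate_pmf m p) (replicate_pmf n q))) {ab}"
      using meas by (simp add: emeasure_distr emeasure_eq_measure emeasure_pmf_single)
  qed auto
qed

end

subsection \<open>Off-diagonal points\<close>

lemma alignment_cong: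
  assumes "word f n = word f' n" "word g n = word g' n"
  shows "alignment f g n S \<longleftrightarrow> alignment f' g' n S"
proof -
  have "f i = f' i" "g i = g' i" if "i \<in> {1..n}" for i
    using assms that by (auto simp: word_def simp del: upt_Suc)
  then have "i \<in> {1..n} \<and> j \<in> {1..n} \<and> f i = g j \<longleftrightarrow> i \<in> {1..n} \<and> j \<in> {1..n} \<and> f' i = g' j" for i j
    by metis
  then show ?thesis unfolding alignment_def by (simp only:)
qed

lemma eq_vimage_image_Int:
  assumes "D \<subseteq> S" "\<And>x y. x \<in> D \<Longrightarrow> y \<in> S \<Longrightarrow> f x = f y \<Longrightarrow> y \<in> D"
  shows "D = f -` (f ` D) \<inter> S"
  using assms by (auto dest: sym)

text \<open>Optimal alignments depend only on the two words of length \<open>n\<close>, so the event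
  is the preimage of a set of word pairs under a measurable map into a discrete space.\<close>

lemma sets_diag_event:
  assumes W: "(\<lambda>\<omega>. (word (\<lambda>i. X i \<omega>) n, word (\<lambda>j. Y j \<omega>) n)) \<in> measurable M (count_space UNIV)"
  shows "diag_event M X Y n k \<epsilon> p1 p2 \<in> sets M"
proof -
  let ?W = "\<lambda>\<omega>. (word (\<lambda>i. X i \<omega>) n, word (\<lambda>j. Y j \<omega>) n)"
  let ?D = "diag_event M X Y n k \<epsilon> p1 p2"
  have saturated: "\<omega>' \<in> ?D" if "\<omega> \<in> ?D" "\<omega>' \<in> space M" "?W \<omega> = ?W \<omega>'" for \<omega> \<omega>'
  proof -
    have w: "word (\<lambda>i. X i \<omega>) n = word (\<lambda>i. X i \<omega>') n" "word (\<lambda>j. Y j \<omega>) n = word (\<lambda>j. Y j \<omega>') n"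
      using that(3) by auto
    have "optimal_alignment (\<lambda>i. X i \<omega>) (\<lambda>j. Y j \<omega>) n S
        \<longleftrightarrow> optimal_alignment (\<lambda>i. X i \<omega>') (\<lambda>j. Y j \<omega>') n S" for S
      unfolding optimal_alignment_def alignment_cong[OF w] w ..
    then show ?thesis using that(1,2) unfolding diag_event_def by simp
  qed
  have "?D = ?W -` (?W ` ?D) \<inter> space M"
  proof (rule eq_vimage_image_Int)
    show "?D \<subseteq> space M" unfolding diag_event_def by auto
  qed (rule saturated)
  then show ?thesis using measurable_sets[OF W, of "?W ` ?D"] by simp
qed

text \<open>A point of an optimal alignment is a cut without loss. The offset of the violated line
  forces \<open>x > n * \<epsilon>\<close> below and, since \<open>p2 > 1\<close>,
  \<open>y > n * \<epsilon>\<close> above, so the cut is far from the origin.\<close>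

lemma off_diagonal_cut:
  assumes \<omega>: "\<omega> \<in> space M - diag_event M X Y n k \<epsilon> p1 p2"
    and p: "0 < p1" "1 < p2" "0 < \<epsilon>"
  obtains x y where "x \<le> n" "y \<le> n" "\<epsilon> * real n \<le> real x + real y"
    "real y \<le> p1 * real x \<or> p2 * real x \<le> real y"
    "0 \<le> cut_gap x y (word (\<lambda>i. X i \<omega>) n) (word (\<lambda>j. Y j \<omega>) n)"
proof -
  obtain S x y where S: "optimal_alignment (\<lambda>i. X i \<omega>) (\<lambda>j. Y j \<omega>) n S" "(x, y) \<in> S"
    and off: "real y < p1 * real x - p1 * real n * \<epsilon> - p1 * real k
      \<or> real y > p2 * real x + p2 * real n * \<epsilon> + p2 * real k"
    using \<omega> unfolding diag_event_def by force
  note cut = alignment_cut[OF conjunct1[OF S(1)[unfolded optimal_alignment_def]] S(2)]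
  have gap: "0 \<le> cut_gap x y (word (\<lambda>i. X i \<omega>) n) (word (\<lambda>j. Y j \<omega>) n)"
    using cut(1) S(1) unfolding cut_gap_def optimal_alignment_def by simp
  have pos: "0 \<le> p1 * (real n * \<epsilon>)" "0 \<le> p1 * real k" "0 \<le> p2 * real k" "0 \<le> p2 * real x"
    "0 \<le> real n * \<epsilon>"
    using p by auto
  have "\<epsilon> * real n \<le> real x + real y \<and> (real y \<le> p1 * real x \<or> p2 * real x \<le> real y)"
    using off
  proof
    assume "real y < p1 * real x - p1 * real n * \<epsilon> - p1 * real k"
    then have y: "real y < p1 * real x - p1 * (real n * \<epsilon>) - p1 * real k" by (simp only: mult.assoc)
    then have "p1 * (real n * \<epsilon>) < p1 * real x" using pos by linarith
    then have "real n * \<epsilon> < real x" using p by simp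
    then show ?thesis using y pos by (simp add: mult.commute)
  next
    assume "p2 * real x + p2 * real n * \<epsilon> + p2 * real k < real y"
    then have y: "p2 * real x + p2 * (real n * \<epsilon>) + p2 * real k < real y" by (simp only: mult.assoc)
    have "1 * (real n * \<epsilon>) \<le> p2 * (real n * \<epsilon>)"
      using p by (intro mult_right_mono) auto
    then show ?thesis using y pos by (simp add: mult.commute)
  qed
  then show ?thesis using that gap cut(2,3) by auto
qed

section \<open>The probability of staying near the diagonal\<close>

theorem theorem4p1:
  fixes M :: "'w measure"
    and X Y :: "nat \<Rightarrow> 'w \<Rightarrow> 'a::finite"
    and \<mu> :: "'a pmf"
    and \<epsilon> \<delta> p1 p2 :: real
  assumes "prob_space M"
    and "prob_space.indep_vars M (\<lambda>_. count_space UNIV) X {1..}"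
    and "prob_space.indep_vars M (\<lambda>_. count_space UNIV) Y {1..}"
    and "prob_space.indep_var M
           (Pi\<^sub>M {1..} (\<lambda>_. count_space UNIV)) (\<lambda>\<omega>. \<lambda>i\<in>{1..}. X i \<omega>)
           (Pi\<^sub>M {1..} (\<lambda>_. count_space UNIV)) (\<lambda>\<omega>. \<lambda>j\<in>{1..}. Y j \<omega>)"
    and "\<And>i. i \<ge> 1 \<Longrightarrow> distr M (count_space UNIV) (X i) = measure_pmf \<mu>"
    and "\<And>j. j \<ge> 1 \<Longrightarrow> distr M (count_space UNIV) (Y j) = measure_pmf \<mu>"
    and "\<nexists>a. \<mu> = return_pmf a"
    and "\<epsilon> > 0"
    and "0 < p1" "p1 < 1" "1 < p2"
    and "gamma_tilde M X Y p1 < gamma_star M X Y"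
    and "gamma_tilde M X Y p2 < gamma_star M X Y"
    and "0 < \<delta>"
    and "\<delta> < min (gamma_star M X Y - gamma_tilde M X Y p1)
                  (gamma_star M X Y - gamma_tilde M X Y p2)"
  shows "\<exists>n0::nat. \<forall>k::nat. k \<ge> 1 \<longrightarrow> (1 + ln (real k)) / real k \<le> \<delta>\<^sup>2 * \<epsilon>\<^sup>2 / 16 \<longrightarrow>
           (\<forall>m n::nat. m \<ge> 1 \<longrightarrow> n = k * m \<longrightarrow> n \<ge> n0 \<longrightarrow>
              measure M (diag_event M X Y n k \<epsilon> p1 p2)
                \<ge> 1 - 2 * exp (- real n * (- ((1 + ln (real k)) / real k) + \<delta>\<^sup>2 * \<epsilon>\<^sup>2 / 16)))"
proof -
  interpret prob_space M by fact
  note \<epsilon> = assms(8) and p = assms(9,10,11) and \<delta> = assms(14,15)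
  have fin: "finite (set_pmf \<mu>)" by simp
  let ?W = "\<lambda>m n \<omega>. (word (\<lambda>i. X i \<omega>) m, word (\<lambda>j. Y j \<omega>) n)"
  let ?R = "\<lambda>n. replicate_pmf n \<mu>"
  have W: "?W m n \<in> measurable M (count_space UNIV)"
    and law: "distr M (count_space UNIV) (?W m n) = measure_pmf (pair_pmf (?R m) (?R n))" for m n
    by (rule distr_word_pair[OF assms(2-6)]; assumption)+
  have mean: "(LINT \<omega>|M. real (LCS_rv X Y m n \<omega>)) = mean_lcs \<mu> m n" for m n
  proof -
    have "mean_lcs \<mu> m n = integral\<^sup>L (distr M (count_space UNIV) (?W m n)) (\<lambda>(u, v). real (lcs_length u v))"
      unfolding mean_lcs_def by (simp add: law)
    also have "\<dots> = (LINT \<omega>|M. real (LCS_rv X Y m n \<omega>))"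
      by (subst integral_distr[OF W]) (auto simp: LCS_rv_def)
    finally show ?thesis ..
  qed
  define g1 where "g1 = gamma_tilde M X Y p1"
  define g2 where "g2 = gamma_tilde M X Y p2"
  define \<gamma> where "\<gamma> = gamma_star M X Y"
  have tilde: "gamma_tilde M X Y r = lim (slope_mean \<mu> r)" for r
    unfolding gamma_tilde_def mean slope_mean_def[abs_def] ..
  have star: "\<gamma> = lim (slope_mean \<mu> 1)"
    unfolding \<gamma>_def gamma_star_def mean slope_mean_def[abs_def] by simp
  define D where "D = \<gamma> - max g1 g2"
  have D: "\<delta> < D" "D \<le> \<gamma> - g1" "D \<le> \<gamma> - g2"
    using \<delta>(2) unfolding D_def g1_def g2_def \<gamma>_def by auto
  \<comment> \<open>The value \<kappa> is the midpoint of \<open>\<delta> * \<epsilon> / 2\<close>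
    and \<open>D * \<epsilon> / 2\<close>, and \<eta> is the other half of the gap, left for the
    convergence error of the diagonal means.\<close>
  define \<eta> where "\<eta> = (D - \<delta>) * \<epsilon> / 4"
  define \<kappa> where "\<kappa> = (D + \<delta>) * \<epsilon> / 4"
  \<comment> \<open>The surplus in the exponent, positive because
    \<open>\<kappa> > \<delta> * \<epsilon> / 2\<close>; it beats the polynomial number of
    cuts.\<close>
  define c where "c = \<kappa>\<^sup>2 / 4 - \<delta>\<^sup>2 * \<epsilon>\<^sup>2 / 16"
  have \<eta>: "\<eta> > 0" and \<kappa>: "\<kappa> > 0"
    unfolding \<eta>_def \<kappa>_def using D(1) \<delta>(1) \<epsilon> by auto
  have "\<delta> * \<epsilon> / 2 < \<kappa>"
    unfolding \<kappa>_def using D(1) \<epsilon> by (simp add: field_simps)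
  then have "(\<delta> * \<epsilon> / 2)\<^sup>2 < \<kappa>\<^sup>2"
    using \<delta>(1) \<epsilon> by (intro power_strict_mono) auto
  then have c: "c > 0" unfolding c_def by (simp add: power_mult_distrib power_divide)
  have \<kappa>_le: "\<kappa> \<le> (\<gamma> - g) * \<epsilon> / 2 - \<eta>" if "D \<le> \<gamma> - g" for g
  proof -
    have "\<kappa> + \<eta> = D * \<epsilon> / 2" unfolding \<kappa>_def \<eta>_def by (simp add: field_simps)
    also have "\<dots> \<le> (\<gamma> - g) * \<epsilon> / 2" using that \<epsilon> by simp
    finally show ?thesis by simp
  qed
  have "\<forall>\<^sub>F n in sequentially. \<gamma> - \<eta> < slope_mean \<mu> 1 n"
    using slope_mean_LIMSEQ[OF fin, of 1] \<eta> unfolding star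
    by (intro order_tendstoD(1)) auto
  moreover have "\<forall>\<^sub>F n in sequentially. (real n + 1)\<^sup>2 * exp (- (c * real n)) < 1"
  proof -
    have "(\<lambda>n. (real n + 1)\<^sup>2 * exp (- (c * real n))) \<longlonglongrightarrow> 0"
      using c by real_asymp
    then show ?thesis by (rule order_tendstoD) simp
  qed
  ultimately have "\<forall>\<^sub>F n in sequentially. n \<ge> 1 \<and> \<gamma> - \<eta> < slope_mean \<mu> 1 n
      \<and> (real n + 1)\<^sup>2 * exp (- (c * real n)) < 1"
    using eventually_ge_at_top[of 1] by eventually_elim auto
  \<comment> \<open>The threshold is fixed before \<open>k\<close> is introduced, so it is uniform
    in \<open>k\<close>.\<close>
  then obtain n0 where n0: "n \<ge> 1" "\<gamma> - \<eta> < slope_mean \<mu> 1 n"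
      "(real n + 1)\<^sup>2 * exp (- (c * real n)) < 1" if "n \<ge> n0" for n
    unfolding eventually_sequentially by blast
  have main: "1 - 2 * exp (- real n * (\<delta>\<^sup>2 * \<epsilon>\<^sup>2 / 16)) \<le> prob (diag_event M X Y n k \<epsilon> p1 p2)"
    if n: "n \<ge> n0" for n k
  proof -
    note n1 = n0[OF n]
    let ?D = "diag_event M X Y n k \<epsilon> p1 p2"
    have diag: "(\<gamma> - \<eta>) * real n \<le> mean_lcs \<mu> n n"
      using n1(1,2) by (simp add: slope_mean_def field_simps)
    define I where "I P = {(x, y). x \<le> n \<and> y \<le> n \<and> \<epsilon> * real n \<le> real x + real y \<and> P x y}"
      for P :: "nat \<Rightarrow> nat \<Rightarrow> bool"
    let ?B = "\<lambda>P. {(u, v). \<exists>(x, y)\<in>I P. 0 \<le> cut_gap x y u v} :: ('a list \<times> 'a list) set"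
    let ?E = "\<lambda>P. ?W n n -` ?B P \<inter> space M"
    have bound: "prob (?E P) \<le> exp (- real n * (\<delta>\<^sup>2 * \<epsilon>\<^sup>2 / 16))"
      if g: "D \<le> \<gamma> - g" and P: "\<And>x y. P x y \<Longrightarrow> mean_lcs \<mu> x y \<le> g * ((real x + real y) / 2)" for P g
    proof -
      have "prob (?E P) = measure_pmf.prob (pair_pmf (?R n) (?R n)) (?B P)"
        using measure_distr[OF W, of "?B P" n n] unfolding law by simp
      also have "\<dots> \<le> (real n + 1)\<^sup>2 * exp (- (\<kappa>\<^sup>2 / 4 * real n))"
      proof (rule prob_some_cut_gap_nonneg[OF fin n1(1) diag[unfolded star] _ \<kappa> \<kappa>_le[OF g, unfolded star]])
        show "g \<le> lim (slope_mean \<mu> 1)" using g D(1) \<delta>(1) star by linarith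
      qed (use P in \<open>auto simp: I_def\<close>)
      \<comment> \<open>Split the rate \<open>\<kappa>\<^sup>2 / 4\<close> into \<open>c\<close> and
        the claimed rate; the part with \<open>c\<close> and the number of cuts together stay below
        1.\<close>
      also have "\<dots> = (real n + 1)\<^sup>2 * exp (- (c * real n)) * exp (- real n * (\<delta>\<^sup>2 * \<epsilon>\<^sup>2 / 16))"
        unfolding c_def by (simp add: mult.assoc algebra_simps flip: exp_add)
      also have "\<dots> \<le> 1 * exp (- real n * (\<delta>\<^sup>2 * \<epsilon>\<^sup>2 / 16))"
        using n1(3) by (intro mult_right_mono) auto
      finally show ?thesis by simp
    qed
    let ?P1 = "\<lambda>x y. real y \<le> p1 * real x" and ?P2 = "\<lambda>x y. p2 * real x \<le> real y"
    have meas: "?E P \<in> events" for P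
      by (rule measurable_sets[OF W]) simp
    have D_meas: "?D \<in> events" by (rule sets_diag_event[OF W])
    have "space M - ?D \<subseteq> ?E ?P1 \<union> ?E ?P2"
    proof
      fix \<omega> assume \<omega>: "\<omega> \<in> space M - ?D"
      obtain x y where "x \<le> n" "y \<le> n" "\<epsilon> * real n \<le> real x + real y" "?P1 x y \<or> ?P2 x y"
        "0 \<le> cut_gap x y (word (\<lambda>i. X i \<omega>) n) (word (\<lambda>j. Y j \<omega>) n)"
        using off_diagonal_cut[OF \<omega> p(1,3) \<epsilon>] by blast
      then show "\<omega> \<in> ?E ?P1 \<union> ?E ?P2" using \<omega> unfolding I_def by auto
    qed
    then have "prob (space M - ?D) \<le> prob (?E ?P1 \<union> ?E ?P2)"
      using meas by (intro finite_measure_mono) auto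
    also have "\<dots> \<le> prob (?E ?P1) + prob (?E ?P2)"
      using meas by (intro measure_Un_le) auto
    also have "prob (?E ?P1) \<le> exp (- real n * (\<delta>\<^sup>2 * \<epsilon>\<^sup>2 / 16))"
      by (rule bound[OF D(2)]) (use mean_lcs_le_below[OF fin p(1,2)] in \<open>simp add: g1_def tilde\<close>)
    also have "prob (?E ?P2) \<le> exp (- real n * (\<delta>\<^sup>2 * \<epsilon>\<^sup>2 / 16))"
      by (rule bound[OF D(3)]) (use mean_lcs_le_above[OF fin p(3)] in \<open>simp add: g2_def tilde\<close>)
    finally show ?thesis using prob_compl[OF D_meas] by simp
  qed
  show ?thesis
  proof (intro exI[of _ n0] allI impI)
    fix k m n :: nat assume "k \<ge> 1" and n: "n \<ge> n0"
    \<comment> \<open>For \<open>k \<ge> 1\<close> the entropy term is nonnegative, so the claimed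
      rate is at most the one in \<open>main\<close>.\<close>
    then have "0 \<le> (1 + ln (real k)) / real k" by simp
    then have "- ((1 + ln (real k)) / real k) + \<delta>\<^sup>2 * \<epsilon>\<^sup>2 / 16 \<le> \<delta>\<^sup>2 * \<epsilon>\<^sup>2 / 16"
      by linarith
    then have "- real n * (- ((1 + ln (real k)) / real k) + \<delta>\<^sup>2 * \<epsilon>\<^sup>2 / 16)
        \<ge> - real n * (\<delta>\<^sup>2 * \<epsilon>\<^sup>2 / 16)"
      by (intro mult_left_mono_neg) auto
    then show "measure M (diag_event M X Y n k \<epsilon> p1 p2)
        \<ge> 1 - 2 * exp (- real n * (- ((1 + ln (real k)) / real k) + \<delta>\<^sup>2 * \<epsilon>\<^sup>2 / 16))"
      using main[OF n, of k] by (smt (verit) exp_le_cancel_iff)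
  qed
qed

end
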